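(* With i.i.d. inputs $\gamma_1,\dots,\gamma_T$ from a distribution $\mathcal{P}$ over truthful-auction requests, over a time horizon $T$, the regret of the bidding algorithm Algorithm R (defined in the context) on the return-on-spend constrained bidding problem (defined in the context) is bounded by $$\mathrm{Regret}(\text{Algorithm R},\mathcal{P}^T)\le O(\sqrt T).$$ Further, the violation of the return-on-spend constraint is at most $2\sqrt T\log T$, that is, the bids $b_1,\dots,b_T$ of Algorithm R satisfy $$\sum_{t=1}^T p_t(b_t)-\sum_{t=1}^T v_t\cdot x_t(b_t)\le 2\sqrt T\log T .$$
   Context: Requests. A request is a tuple $\gamma=(v,x,p)$ with value $v\in[0,1]$, non-decreasing allocation function $x:\mathbb{R}_{\ge 0}\to[0,1]$, and payment function $p:\mathbb{R}_{\ge 0}\to[0,1]$ satisfying $p(b)=b\,x(b)-\int_0^b x(z)\,dz$ (truthful auction). Over $T$ rounds requests $\gamma_t=(v_t,x_t,p_t)$ arrive. In round $t$ the bidder sees $v_t$, chooses a bid $b_t\ge 0$, then observes $x_t(b_t)$ and $p_t(b_t)$. Put $g_t(b)=v_t\,x_t(b)-p_t(b)$. Problem. Maximize $\sum_{t=1}^T v_t x_t(b_t)$ over bids $b_t\ge0$ subject to the return-on-spend (RoS) constraint $\sum_{t=1}^T p_t(b_t)\le\sum_{t=1}^T v_t x_t(b_t)$. For a request sequence $\vec\gamma$, $\mathrm{Reward}(\mathrm{Opt},\vec\gamma)$ is the optimal value of this problem, in hindsight. For an algorithm Alg producing bids $b_t$, $\mathrm{Reward}(\mathrm{Alg},\vec\gamma)=\sum_{t=1}^T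 v_t x_t(b_t)$, and $\mathrm{Regret}(\mathrm{Alg},\mathcal{P}^T)=\mathbb{E}_{\vec\gamma\sim\mathcal{P}^T}[\mathrm{Reward}(\mathrm{Opt},\vec\gamma)-\mathrm{Reward}(\mathrm{Alg},\vec\gamma)]$. Algorithm R (horizon $T$). Set $\lambda_1=1$, $\alpha=1/\sqrt T$. For $t=1,\dots,T$: observe $v_t$, bid $b_t=\frac{1+\lambda_t}{\lambda_t}v_t$, compute $g_t(b_t)$, and set $\lambda_{t+1}=\lambda_t\exp(-\alpha\,g_t(b_t))$.
   Formalization: The bound on the violation of the return-on-spend constraint is stated for T at least 2; at T = 1 the right side is 0 and the claim fails (v = 1/2, x = 1 from bid 1 on and 0 below, gives violation 1/2). *)

theory Defs
  imports "HOL-Probability.Probability"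
begin

type_synonym request = "real \<times> (real \<Rightarrow> real) \<times> (real \<Rightarrow> real)"

definition val :: "request \<Rightarrow> real" where
  "val \<gamma> = fst \<gamma>"

definition alloc :: "request \<Rightarrow> real \<Rightarrow> real" where
  "alloc \<gamma> = fst (snd \<gamma>)"

definition pay :: "request \<Rightarrow> real \<Rightarrow> real" where
  "pay \<gamma> = snd (snd \<gamma>)"

text \<open>Allocation and payment are functions on the nonnegative reals; their values at negative
  bids are arbitrary and never used.\<close>

definition truthful_request :: "request \<Rightarrow> bool" where
  "truthful_request \<gamma> \<longleftrightarrow>
     val \<gamma> \<in> {0..1} \<and>
     alloc \<gamma> \<in> {0..} \<rightarrow> {0..1} \<and> mono_on {0..} (alloc \<gamma>) \<and>
     pay \<gamma> \<in> {0..} \<rightarrow> {0..1} \<and>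
     (\<forall>b\<ge>0. pay \<gamma> b = b * alloc \<gamma> b - integral {0..b} (alloc \<gamma>))"

text \<open>There is no canonical sigma-algebra on requests. Any is allowed for which the value is
  measurable and the allocation is jointly measurable in the request and the bid; without joint
  measurability the allocation at a random bid need not be a random variable. Joint measurability
  of the payment follows from the payment formula.\<close>

definition request_distribution :: "request measure \<Rightarrow> bool" where
  "request_distribution P \<longleftrightarrow>
     prob_space P \<and>
     (\<forall>\<gamma>\<in>space P. truthful_request \<gamma>) \<and>
     val \<in> borel_measurable P \<and>
     (\<lambda>(\<gamma>, b). alloc \<gamma> b) \<in> borel_measurable (P \<Otimes>\<^sub>M restrict_space borel {0..})"

text \<open>The rounds \<open>1, \<dots>, T\<close> are indexed by \<open>0, \<dots>, T - 1\<close>.\<close>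

definition reward :: "nat \<Rightarrow> (nat \<Rightarrow> request) \<Rightarrow> (nat \<Rightarrow> real) \<Rightarrow> real" where
  "reward T \<gamma> b = (\<Sum>t<T. val (\<gamma> t) * alloc (\<gamma> t) (b t))"

definition spend :: "nat \<Rightarrow> (nat \<Rightarrow> request) \<Rightarrow> (nat \<Rightarrow> real) \<Rightarrow> real" where
  "spend T \<gamma> b = (\<Sum>t<T. pay (\<gamma> t) (b t))"

definition feasible_bids :: "nat \<Rightarrow> (nat \<Rightarrow> request) \<Rightarrow> (nat \<Rightarrow> real) set" where
  "feasible_bids T \<gamma> = {b. (\<forall>t<T. 0 \<le> b t) \<and> spend T \<gamma> b \<le> reward T \<gamma> b}"

text \<open>For truthful requests the supremum is over a nonempty set (bidding 0 throughout is feasible)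
  bounded above by \<open>T\<close>. It need not be attained.\<close>

definition reward_opt :: "nat \<Rightarrow> (nat \<Rightarrow> request) \<Rightarrow> real" where
  "reward_opt T \<gamma> = (SUP b\<in>feasible_bids T \<gamma>. reward T \<gamma> b)"

text \<open>An algorithm for horizon \<open>T\<close> is represented by the map from the request sequence to the
  sequence of bids that it places.\<close>

type_synonym algorithm = "nat \<Rightarrow> (nat \<Rightarrow> request) \<Rightarrow> nat \<Rightarrow> real"

definition request_seq :: "request measure \<Rightarrow> nat \<Rightarrow> (nat \<Rightarrow> request) measure" where
  "request_seq P T = (\<Pi>\<^sub>M t\<in>{..<T}. P)"

definition hindsight_gap :: "algorithm \<Rightarrow> nat \<Rightarrow> (nat \<Rightarrow> request) \<Rightarrow> real" where
  "hindsight_gap alg T \<gamma> = reward_opt T \<gamma> - reward T \<gamma> (alg T \<gamma>)"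

definition regret :: "algorithm \<Rightarrow> request measure \<Rightarrow> nat \<Rightarrow> real" where
  "regret alg P T = (\<integral>\<gamma>. hindsight_gap alg T \<gamma> \<partial>request_seq P T)"

definition gain :: "request \<Rightarrow> real \<Rightarrow> real" where
  "gain \<gamma> b = val \<gamma> * alloc \<gamma> b - pay \<gamma> b"

definition dual_bid :: "real \<Rightarrow> request \<Rightarrow> real" where
  "dual_bid l \<gamma> = (1 + l) / l * val \<gamma>"

primrec dual_R :: "nat \<Rightarrow> (nat \<Rightarrow> request) \<Rightarrow> nat \<Rightarrow> real" where
  "dual_R T \<gamma> 0 = 1"
| "dual_R T \<gamma> (Suc t) =
     dual_R T \<gamma> t * exp (- (1 / sqrt (real T)) * gain (\<gamma> t) (dual_bid (dual_R T \<gamma> t) (\<gamma> t)))"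

definition algorithm_R :: algorithm where
  "algorithm_R T \<gamma> t = dual_bid (dual_R T \<gamma> t) (\<gamma> t)"

end

theory Submission
  imports Defs
begin

text \<open>Bidding \<open>dual_bid l \<gamma>\<close> maximizes the Lagrangian \<open>val \<gamma> * alloc \<gamma> b + l * gain \<gamma> b\<close> by
  truthfulness, and for every fixed \<open>l > 0\<close> the expected hindsight optimum is at most \<open>T\<close> times the
  expectation of this maximum. The multiplier of a round is independent of its request, so the regret
  is at most the expectation of the sum of \<open>l\<^sub>t * g\<^sub>t\<close>. Truthfulness also gives \<open>- g\<^sub>t \<le> 1 / l\<^sub>t\<close>.
  Hence \<open>l\<^sub>t\<close> grows by at most \<open>\<alpha> + \<alpha>\<^sup>2\<close> per round, which bounds the violation
  \<open>ln l / \<alpha>\<close>, and a telescoping second-order estimate bounds the sum of \<open>l\<^sub>t * g\<^sub>t\<close> by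
  \<open>5 * sqrt T\<close>.\<close>

section \<open>Truthful requests\<close>

lemma truthful_requestD:
  assumes "truthful_request \<gamma>"
  shows val_nonneg: "0 \<le> val \<gamma>" and val_le_1: "val \<gamma> \<le> 1"
    and alloc_nonneg: "0 \<le> b \<Longrightarrow> 0 \<le> alloc \<gamma> b" and alloc_le_1: "0 \<le> b \<Longrightarrow> alloc \<gamma> b \<le> 1"
    and pay_nonneg: "0 \<le> b \<Longrightarrow> 0 \<le> pay \<gamma> b" and pay_le_1: "0 \<le> b \<Longrightarrow> pay \<gamma> b \<le> 1"
    and alloc_mono: "0 \<le> a \<Longrightarrow> a \<le> b \<Longrightarrow> alloc \<gamma> a \<le> alloc \<gamma> b"
    and pay_eq: "0 \<le> b \<Longrightarrow> pay \<gamma> b = b * alloc \<gamma> b - integral {0..b} (alloc \<gamma>)"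
  using assms unfolding truthful_request_def by (auto simp: Pi_iff mono_on_def)

lemma alloc_integrable_on:
  assumes "truthful_request \<gamma>" "0 \<le> a"
  shows "alloc \<gamma> integrable_on {a..b}"
  using assms by (intro integrable_on_mono_on) (auto simp: mono_on_def intro: alloc_mono)

text \<open>The right side exceeds the left by the integral, between the two bids, of the distance
  from \<open>alloc \<gamma> z\<close> to \<open>alloc \<gamma> b\<close>. Monotonicity gives the
  integrand the required sign in either order of the bids.\<close>

lemma truthful_incentive_compatible:
  assumes \<gamma>: "truthful_request \<gamma>" and a: "0 \<le> a" and b: "0 \<le> b"
  shows "a * alloc \<gamma> b - pay \<gamma> b \<le> a * alloc \<gamma> a - pay \<gamma> a"
proof (cases "a \<le> b")
  case True
  have "integral {0..a} (alloc \<gamma>) + integral {a..b} (alloc \<gamma>) = integral {0..b} (alloc \<gamma>)"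
    by (rule Henstock_Kurzweil_Integration.integral_combine) (use a True alloc_integrable_on[OF \<gamma>] in auto)
  moreover have "integral {a..b} (alloc \<gamma>) \<le> integral {a..b} (\<lambda>_. alloc \<gamma> b)"
    by (rule integral_le) (use a alloc_integrable_on[OF \<gamma>] alloc_mono[OF \<gamma>] in auto)
  ultimately show ?thesis
    using True by (simp add: pay_eq[OF \<gamma> a] pay_eq[OF \<gamma> b] algebra_simps)
next
  case False
  then have ba: "b \<le> a" by simp
  have "integral {0..b} (alloc \<gamma>) + integral {b..a} (alloc \<gamma>) = integral {0..a} (alloc \<gamma>)"
    by (rule Henstock_Kurzweil_Integration.integral_combine) (use b ba alloc_integrable_on[OF \<gamma>] in auto)
  moreover have "integral {b..a} (\<lambda>_. alloc \<gamma> b) \<le> integral {b..a} (alloc \<gamma>)"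
    by (rule integral_le) (use b alloc_integrable_on[OF \<gamma>] alloc_mono[OF \<gamma>] in auto)
  ultimately show ?thesis
    using ba by (simp add: pay_eq[OF \<gamma> a] pay_eq[OF \<gamma> b] algebra_simps)
qed

lemma gain_le_1:
  assumes "truthful_request \<gamma>" "0 \<le> b"
  shows "gain \<gamma> b \<le> 1"
  using mult_le_one[of "val \<gamma>" "alloc \<gamma> b"] assms truthful_requestD[OF assms(1)]
  by (fastforce simp: gain_def)

lemma gain_ge_neg_1:
  assumes "truthful_request \<gamma>" "0 \<le> b"
  shows "- 1 \<le> gain \<gamma> b"
proof -
  have "0 \<le> val \<gamma> * alloc \<gamma> b"
    using assms truthful_requestD[OF assms(1)] by (intro mult_nonneg_nonneg) auto
  then show ?thesis
    using pay_le_1[OF assms] by (simp add: gain_def)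
qed

text \<open>For a bidder of value \<open>a\<close>, the extra allocation at \<open>b\<close> is not
  worth its extra price. It is worth even less to a bidder of value
  \<open>val \<gamma> \<le> a\<close>.\<close>

lemma gain_antimono:
  assumes \<gamma>: "truthful_request \<gamma>" and "val \<gamma> \<le> a" "a \<le> b"
  shows "gain \<gamma> b \<le> gain \<gamma> a"
proof -
  have a: "0 \<le> a" and b: "0 \<le> b" using assms val_nonneg[OF \<gamma>] by auto
  have "val \<gamma> * (alloc \<gamma> b - alloc \<gamma> a) \<le> a * (alloc \<gamma> b - alloc \<gamma> a)"
    using alloc_mono[OF \<gamma> a, of b] assms by (intro mult_right_mono) auto
  then show ?thesis
    using truthful_incentive_compatible[OF \<gamma> a b] by (simp add: gain_def algebra_simps)
qed

lemma gain_at_val: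
  assumes \<gamma>: "truthful_request \<gamma>" and "0 \<le> b"
  shows "gain \<gamma> b \<le> gain \<gamma> (val \<gamma>)"
  using truthful_incentive_compatible[OF \<gamma> val_nonneg[OF \<gamma>] assms(2)] by (simp add: gain_def)

section \<open>One round\<close>

lemma dual_bid_nonneg:
  assumes "truthful_request \<gamma>" "0 < l"
  shows "0 \<le> dual_bid l \<gamma>"
  using assms val_nonneg by (simp add: dual_bid_def)

text \<open>The contribution of one request to the dual function: the maximum over bids, encoded
  through its maximizer so that it needs no supremum.\<close>

definition lagrangian :: "real \<Rightarrow> request \<Rightarrow> real" where
  "lagrangian l \<gamma> = val \<gamma> * alloc \<gamma> (dual_bid l \<gamma>) + l * gain \<gamma> (dual_bid l \<gamma>)"

text \<open>The Lagrangian of a bid \<open>b\<close> is \<open>l\<close> times the utility of \<open>b\<close> for a bidder with value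
  \<open>dual_bid l \<gamma>\<close>, so bidding that value truthfully is optimal.\<close>

lemma lagrangian_optimal:
  assumes \<gamma>: "truthful_request \<gamma>" and l: "0 < l" and b: "0 \<le> b"
  shows "val \<gamma> * alloc \<gamma> b + l * gain \<gamma> b \<le> lagrangian l \<gamma>"
proof -
  have eq: "val \<gamma> * alloc \<gamma> c + l * gain \<gamma> c = l * (dual_bid l \<gamma> * alloc \<gamma> c - pay \<gamma> c)" for c
    using l by (simp add: gain_def dual_bid_def field_simps)
  show ?thesis
    unfolding lagrangian_def eq
    using l truthful_incentive_compatible[OF \<gamma> dual_bid_nonneg[OF \<gamma> l] b]
    by (intro mult_left_mono) auto
qed

lemma lagrangian_abs_le:
  assumes \<gamma>: "truthful_request \<gamma>" and l: "0 < l"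
  shows "\<bar>lagrangian l \<gamma>\<bar> \<le> 1 + l"
proof -
  note b = dual_bid_nonneg[OF \<gamma> l]
  have "0 \<le> val \<gamma> * alloc \<gamma> (dual_bid l \<gamma>)" "val \<gamma> * alloc \<gamma> (dual_bid l \<gamma>) \<le> 1"
    using truthful_requestD[OF \<gamma>] b by (auto intro: mult_le_one)
  moreover have "\<bar>l * gain \<gamma> (dual_bid l \<gamma>)\<bar> \<le> l"
    using gain_le_1[OF \<gamma> b] gain_ge_neg_1[OF \<gamma> b] l by (simp add: abs_mult)
  ultimately show ?thesis by (simp add: lagrangian_def)
qed

text \<open>Bidding 0 costs nothing, so the optimal Lagrangian is nonnegative, and its value part is
  at most 1. A large multiplier therefore sees only slightly negative gains.\<close>

lemma dual_gain_ge:
  assumes \<gamma>: "truthful_request \<gamma>" and l: "0 < l"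
  shows "- 1 \<le> l * gain \<gamma> (dual_bid l \<gamma>)"
proof -
  note b = dual_bid_nonneg[OF \<gamma> l]
  have "0 \<le> dual_bid l \<gamma> * alloc \<gamma> 0"
    using b alloc_nonneg[OF \<gamma>] by simp
  then have "0 \<le> lagrangian l \<gamma>"
    using lagrangian_optimal[OF \<gamma> l, of 0] pay_eq[OF \<gamma>, of 0] l val_nonneg[OF \<gamma>] alloc_nonneg[OF \<gamma>, of 0]
    by (auto simp: gain_def intro: order_trans[rotated])
  moreover have "val \<gamma> * alloc \<gamma> (dual_bid l \<gamma>) \<le> 1"
    using truthful_requestD[OF \<gamma>] b by (auto intro: mult_le_one)
  ultimately show ?thesis by (simp add: lagrangian_def)
qed

section \<open>Multiplicative weights\<close>

text \<open>The claimed bound times the quadratic Taylor lower bound of \<open>exp x\<close> is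
  \<open>1 + x ^ 4 / 4\<close>, hence at least 1.\<close>

lemma exp_minus_le_quadratic:
  fixes x :: real
  assumes "0 \<le> x"
  shows "exp (- x) \<le> 1 - x + x\<^sup>2 / 2"
proof -
  have pos: "0 < 1 + x + x\<^sup>2 / 2"
    using assms by (simp add: add_pos_nonneg)
  have "exp (- x) = 1 / exp x"
    by (simp add: exp_minus divide_simps)
  also have "\<dots> \<le> 1 / (1 + x + x\<^sup>2 / 2)"
    using exp_lower_Taylor_quadratic[OF assms] pos by (intro divide_left_mono) auto
  also have "\<dots> \<le> 1 - x + x\<^sup>2 / 2"
  proof -
    have "(1 - x + x\<^sup>2 / 2) * (1 + x + x\<^sup>2 / 2) = 1 + x ^ 4 / 4"
      by (simp add: field_simps power2_eq_square power4_eq_xxxx)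
    then show ?thesis using pos by (simp add: divide_le_eq)
  qed
  finally show ?thesis .
qed

text \<open>Only \<open>g < 0\<close> increases the weight. With \<open>h = - g\<close>, the
  first-order increase is \<open>\<alpha> * (l * h)\<close> and the second-order one at most
  \<open>\<alpha>\<^sup>2 * (l * h) * h\<close>, so \<open>l * h \<le> 1\<close> turns
  multiplicative growth into additive growth.\<close>

lemma weight_step_growth:
  fixes l g \<alpha> :: real
  assumes l: "0 < l" and \<alpha>: "0 < \<alpha>" "\<alpha> \<le> 1" and g: "- 1 \<le> g" "- 1 \<le> l * g"
  shows "l * exp (- (\<alpha> * g)) \<le> l + \<alpha> + \<alpha>\<^sup>2"
proof (cases "0 \<le> g")
  case True
  then have "l * exp (- (\<alpha> * g)) \<le> l * 1"
    using l \<alpha> by (intro mult_left_mono) auto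
  then show ?thesis using \<alpha> by (smt (verit) zero_le_power2)
next
  case False
  define h where "h = - g"
  have h: "0 \<le> h" "h \<le> 1" "l * h \<le> 1"
    using False g by (auto simp: h_def)
  have "exp (\<alpha> * h) \<le> 1 + \<alpha> * h + (\<alpha> * h)\<^sup>2"
    using h \<alpha> by (intro exp_bound) (auto intro: mult_le_one)
  then have "l * exp (\<alpha> * h) \<le> l * (1 + \<alpha> * h + (\<alpha> * h)\<^sup>2)"
    using l by (intro mult_left_mono) auto
  also have "\<dots> = l + \<alpha> * (l * h) + \<alpha>\<^sup>2 * (l * h) * h"
    by (simp add: algebra_simps power2_eq_square)
  also have "\<dots> \<le> l + \<alpha> * 1 + \<alpha>\<^sup>2 * 1 * 1"
    using h \<alpha> l by (intro add_mono mult_mono) auto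
  finally show ?thesis by (simp add: h_def)
qed

text \<open>For \<open>g \<ge> 0\<close> the second-order error is at most
  \<open>\<alpha>\<^sup>2 / 2 * (l * g)\<close>. As \<open>l\<close> may be large, it is absorbed by
  the factor \<open>1 - \<alpha> / 2\<close> instead of being bounded by a constant. For
  \<open>g < 0\<close> the error is at most \<open>\<alpha>\<^sup>2\<close>, and the same factor
  costs another \<open>\<alpha>\<^sup>2 / 2\<close>.\<close>

lemma weight_step_regret:
  fixes l g \<alpha> :: real
  assumes l: "0 < l" and \<alpha>: "0 < \<alpha>" "\<alpha> \<le> 1" and g: "- 1 \<le> g" "g \<le> 1" "- 1 \<le> l * g"
  shows "\<alpha> * (1 - \<alpha> / 2) * (l * g) \<le> l - l * exp (- (\<alpha> * g)) + 3 / 2 * \<alpha>\<^sup>2"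
proof (cases "0 \<le> g")
  case True
  have "l * exp (- (\<alpha> * g)) \<le> l * (1 - \<alpha> * g + (\<alpha> * g)\<^sup>2 / 2)"
    using True l \<alpha> by (intro mult_left_mono exp_minus_le_quadratic) auto
  moreover have "\<alpha>\<^sup>2 * (l * g) * g \<le> \<alpha>\<^sup>2 * (l * g) * 1"
    using True l g by (intro mult_left_mono) auto
  moreover have "0 \<le> \<alpha> * \<alpha>" by simp
  ultimately show ?thesis
    by (simp add: algebra_simps power2_eq_square del: zero_le_square)
next
  case False
  define h where "h = - g"
  have h: "0 \<le> h" "h \<le> 1" "l * h \<le> 1"
    using False g by (auto simp: h_def)
  have "exp (\<alpha> * h) \<le> 1 + \<alpha> * h + (\<alpha> * h)\<^sup>2"
    using h \<alpha> by (intro exp_bound) (auto intro: mult_le_one)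
  then have "l * exp (\<alpha> * h) \<le> l * (1 + \<alpha> * h + (\<alpha> * h)\<^sup>2)"
    using l by (intro mult_left_mono) auto
  moreover have "\<alpha>\<^sup>2 * (l * h) * h \<le> \<alpha>\<^sup>2 * 1 * 1"
    using h l by (intro mult_mono) auto
  moreover have "\<alpha>\<^sup>2 * (l * h) \<le> \<alpha>\<^sup>2 * 1"
    using h by (intro mult_left_mono) auto
  ultimately show ?thesis
    by (simp add: algebra_simps power2_eq_square h_def)
qed

section \<open>The multiplier along a run of Algorithm R\<close>

lemma dual_R_pos: "0 < dual_R T \<gamma> t"
  by (induction t) auto

context
  fixes T :: nat and \<gamma> :: "nat \<Rightarrow> request"
  assumes T: "1 \<le> T" and truthful: "\<And>t. t < T \<Longrightarrow> truthful_request (\<gamma> t)"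
begin

lemma algorithm_R_nonneg:
  assumes "t < T"
  shows "0 \<le> algorithm_R T \<gamma> t"
  unfolding algorithm_R_def by (intro dual_bid_nonneg truthful assms dual_R_pos)

lemma dual_R_Suc_le:
  assumes "t < T"
  shows "dual_R T \<gamma> (Suc t) \<le> dual_R T \<gamma> t + 1 / sqrt T + 1 / T"
  using weight_step_growth[of "dual_R T \<gamma> t" "1 / sqrt T" "gain (\<gamma> t) (algorithm_R T \<gamma> t)"]
    gain_ge_neg_1[OF truthful[OF assms] algorithm_R_nonneg[OF assms]]
    dual_gain_ge[OF truthful[OF assms] dual_R_pos[of T \<gamma> t]] dual_R_pos[of T \<gamma> t] T
  by (simp add: algorithm_R_def power_divide)

lemma dual_R_le:
  assumes "t \<le> T"
  shows "dual_R T \<gamma> t \<le> 1 + t * (1 / sqrt T + 1 / T)"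
  using assms
proof (induction t)
  case (Suc t)
  then show ?case
    using dual_R_Suc_le[of t] by (simp add: algebra_simps add_divide_distrib del: dual_R.simps)
qed simp

lemma dual_R_le_horizon:
  assumes "t \<le> T"
  shows "dual_R T \<gamma> t \<le> 2 + sqrt T"
proof -
  have "real t * (1 / sqrt T + 1 / T) \<le> real T * (1 / sqrt T + 1 / T)"
    using assms by (intro mult_right_mono) auto
  also have "\<dots> = sqrt T + 1"
    using T by (simp add: algebra_simps real_div_sqrt)
  finally show ?thesis using dual_R_le[OF assms] by simp
qed

lemma dual_gain_sum_le:
  "(\<Sum>t<T. dual_R T \<gamma> t * gain (\<gamma> t) (algorithm_R T \<gamma> t)) \<le> 5 * sqrt T"
proof -
  define \<alpha> where "\<alpha> = 1 / sqrt T"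
  define S where "S = (\<Sum>t<T. dual_R T \<gamma> t * gain (\<gamma> t) (algorithm_R T \<gamma> t))"
  have \<alpha>: "0 < \<alpha>" "\<alpha> \<le> 1" "\<alpha>\<^sup>2 = 1 / T"
    using T by (auto simp: \<alpha>_def power_divide)
  have "\<alpha> * (1 - \<alpha> / 2) * S
      = (\<Sum>t<T. \<alpha> * (1 - \<alpha> / 2) * (dual_R T \<gamma> t * gain (\<gamma> t) (algorithm_R T \<gamma> t)))"
    by (simp add: S_def sum_distrib_left)
  also have "\<dots> \<le> (\<Sum>t<T. dual_R T \<gamma> t - dual_R T \<gamma> (Suc t) + 3 / 2 * \<alpha>\<^sup>2)"
  proof (rule sum_mono)
    fix t assume "t \<in> {..<T}"
    then have t: "t < T" by simp
    show "\<alpha> * (1 - \<alpha> / 2) * (dual_R T \<gamma> t * gain (\<gamma> t) (algorithm_R T \<gamma> t))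
        \<le> dual_R T \<gamma> t - dual_R T \<gamma> (Suc t) + 3 / 2 * \<alpha>\<^sup>2"
      using weight_step_regret[OF dual_R_pos \<alpha>(1,2) gain_ge_neg_1 gain_le_1,
          OF truthful[OF t] algorithm_R_nonneg[OF t] truthful[OF t] algorithm_R_nonneg[OF t], of T \<gamma> t]
        dual_gain_ge[OF truthful[OF t] dual_R_pos[of T \<gamma> t]]
      by (simp add: algorithm_R_def \<alpha>_def)
  qed
  \<comment> \<open>The sum telescopes from the initial multiplier 1, and the errors add up to
    \<open>3 / 2\<close> because \<open>\<alpha>\<^sup>2 = 1 / T\<close>.\<close>
  also have "\<dots> = 1 - dual_R T \<gamma> T + 3 / 2"
    using T by (simp add: sum.distrib sum_lessThan_telescope' \<alpha>(3) del: dual_R.simps(2))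
  also have "\<dots> \<le> 5 / 2"
    using dual_R_pos[of T \<gamma> T] by simp
  finally have *: "\<alpha> * (1 - \<alpha> / 2) * S \<le> 5 / 2" .
  show ?thesis
  \<comment> \<open>Lowering the factor \<open>1 - \<alpha> / 2\<close> to \<open>1 / 2\<close> is
    sound only for nonnegative \<open>S\<close>; a negative \<open>S\<close> satisfies the bound
    trivially.\<close>
  proof (cases "0 \<le> S")
    case True
    have "\<alpha> * (1 / 2) * S \<le> \<alpha> * (1 - \<alpha> / 2) * S"
      using True \<alpha> by (intro mult_right_mono mult_left_mono) auto
    then have "\<alpha> * S \<le> 5" using * by simp
    then show ?thesis
      using T by (simp add: \<alpha>_def S_def divide_le_eq)
  next
    case False
    have "0 \<le> 5 * sqrt T" by simp
    then show ?thesis using False unfolding S_def by linarith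
  qed
qed

text \<open>The exponential update is additive in the logarithm, so the final multiplier records the
  whole constraint violation.\<close>

lemma ln_dual_R:
  assumes "t \<le> T"
  shows "ln (dual_R T \<gamma> t) = - (\<Sum>s<t. gain (\<gamma> s) (algorithm_R T \<gamma> s)) / sqrt T"
  using assms
proof (induction t)
  case (Suc t)
  then show ?case
    using dual_R_pos[of T \<gamma> t] by (simp add: ln_mult algorithm_R_def diff_divide_distrib)
qed simp

lemma violation_le:
  assumes "2 \<le> T"
  shows "spend T \<gamma> (algorithm_R T \<gamma>) - reward T \<gamma> (algorithm_R T \<gamma>) \<le> 2 * sqrt T * ln T"
proof -
  \<comment> \<open>The square produces the factor 2 in front of \<open>ln T\<close>. The inequality
    follows from \<open>sqrt T \<le> T\<close> and \<open>2 + T \<le> 2 * T\<close>, and fails at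
    \<open>T = 1\<close>.\<close>
  have "2 + sqrt T \<le> (real T)\<^sup>2"
  proof -
    have "1 * sqrt T \<le> sqrt T * sqrt T"
      using T by (intro mult_right_mono) auto
    moreover have "2 * real T \<le> (real T)\<^sup>2"
      using assms by (simp add: power2_eq_square)
    ultimately show ?thesis using assms by simp
  qed
  then have "dual_R T \<gamma> T \<le> (real T)\<^sup>2"
    using dual_R_le_horizon[of T] by simp
  then have "ln (dual_R T \<gamma> T) \<le> ln ((real T)\<^sup>2)"
    using dual_R_pos[of T \<gamma> T] T by (subst ln_le_cancel_iff) auto
  also have "\<dots> = 2 * ln T"
    using T by (simp add: ln_realpow)
  finally have "- (\<Sum>s<T. gain (\<gamma> s) (algorithm_R T \<gamma> s)) \<le> 2 * ln T * sqrt T"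
    using T by (simp add: ln_dual_R pos_divide_le_eq del: minus_divide_left[symmetric])
  then show ?thesis
    by (simp add: spend_def reward_def gain_def sum_subtractf algebra_simps)
qed

end

section \<open>Measurability of the hindsight optimum\<close>

lemma measurable_alloc:
  assumes P: "request_distribution P" and g: "g \<in> M \<rightarrow>\<^sub>M P" and f: "f \<in> borel_measurable M"
    and nonneg: "\<And>\<omega>. \<omega> \<in> space M \<Longrightarrow> 0 \<le> f \<omega>"
  shows "(\<lambda>\<omega>. alloc (g \<omega>) (f \<omega>)) \<in> borel_measurable M"
proof -
  have "(\<lambda>(\<gamma>, b). alloc \<gamma> b) \<in> borel_measurable (P \<Otimes>\<^sub>M restrict_space borel {0..})"
    using P by (simp add: request_distribution_def)
  moreover have "(\<lambda>\<omega>. (g \<omega>, f \<omega>)) \<in> M \<rightarrow>\<^sub>M P \<Otimes>\<^sub>M restrict_space borel {0..}"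
    using g f nonneg by (intro measurable_Pair measurable_restrict_space2) auto
  ultimately have "(\<lambda>\<omega>. (\<lambda>(\<gamma>, b). alloc \<gamma> b) (g \<omega>, f \<omega>)) \<in> borel_measurable M"
    by (rule measurable_compose[rotated])
  then show ?thesis by simp
qed

lemma measurable_val:
  assumes "request_distribution P" "g \<in> M \<rightarrow>\<^sub>M P"
  shows "(\<lambda>\<omega>. val (g \<omega>)) \<in> borel_measurable M"
  using assms by (intro measurable_compose[of g M P val]) (simp_all add: request_distribution_def)

lemma truthful_in_space:
  assumes "request_distribution P" "\<gamma> \<in> space P"
  shows "truthful_request \<gamma>"
  using assms by (simp add: request_distribution_def)

lemma measurable_pay:
  assumes P: "request_distribution P" and g: "g \<in> M \<rightarrow>\<^sub>M P" and f: "f \<in> borel_measurable M"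
    and nonneg: "\<And>\<omega>. \<omega> \<in> space M \<Longrightarrow> 0 \<le> f \<omega>"
  shows "(\<lambda>\<omega>. pay (g \<omega>) (f \<omega>)) \<in> borel_measurable M"
proof -
  \<comment> \<open>The payment formula as a Lebesgue integral with a parameter, which is measurable
    in the parameter. The clamp \<open>max 0 z\<close> keeps the bid where joint measurability is
    assumed and changes nothing on the range of integration.\<close>
  let ?I = "\<lambda>\<omega>. \<integral>z. indicator {0..f \<omega>} z * alloc (g \<omega>) (max 0 z) \<partial>lborel"
  note [measurable] = g f
  have [measurable]: "(\<lambda>\<omega>. alloc (g (fst \<omega>)) (max 0 (snd \<omega>))) \<in> borel_measurable (M \<Otimes>\<^sub>M lborel)"
    by (rule measurable_alloc[OF P]) auto
  have "(\<lambda>\<omega>. f \<omega> * alloc (g \<omega>) (f \<omega>) - ?I \<omega>) \<in> borel_measurable M"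
  proof (intro borel_measurable_diff borel_measurable_times f measurable_alloc[OF P g f nonneg])
    have "(\<lambda>(\<omega>, z). indicator {0..f \<omega>} z * alloc (g \<omega>) (max 0 z)) \<in> borel_measurable (M \<Otimes>\<^sub>M lborel)"
      unfolding split_beta' indicator_def atLeastAtMost_iff by measurable
    then show "?I \<in> borel_measurable M"
      by (rule lborel.borel_measurable_lebesgue_integral)
  qed auto
  moreover have "pay (g \<omega>) (f \<omega>) = f \<omega> * alloc (g \<omega>) (f \<omega>) - ?I \<omega>" if \<omega>: "\<omega> \<in> space M" for \<omega>
  proof -
    have t: "truthful_request (g \<omega>)"
      using truthful_in_space[OF P] measurable_space[OF g \<omega>] .
    have [measurable]: "(\<lambda>z. alloc (g \<omega>) (max 0 z)) \<in> borel_measurable lborel"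
      using measurable_Pair2[OF _ \<omega>, of "\<lambda>\<omega>. alloc (g (fst \<omega>)) (max 0 (snd \<omega>))" lborel borel] by simp
    have "set_integrable lborel {0..f \<omega>} (\<lambda>z. alloc (g \<omega>) (max 0 z))"
    proof (rule set_integrable_bound)
      show "set_integrable lborel {0..f \<omega>} (\<lambda>_. 1 :: real)"
        using nonneg[OF \<omega>] by (simp add: set_integrable_def integrable_indicator_iff)
      show "set_borel_measurable lborel {0..f \<omega>} (\<lambda>z. alloc (g \<omega>) (max 0 z))"
        unfolding set_borel_measurable_def by measurable
    qed (use truthful_requestD[OF t] in auto)
    from set_borel_integral_eq_integral(2)[OF this]
    have "?I \<omega> = integral {0..f \<omega>} (\<lambda>z. alloc (g \<omega>) (max 0 z))"
      by (simp add: set_lebesgue_integral_def)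
    also have "\<dots> = integral {0..f \<omega>} (alloc (g \<omega>))"
      by (rule integral_cong) (simp add: max_def)
    finally show ?thesis
      using pay_eq[OF t nonneg[OF \<omega>]] by simp
  qed
  ultimately show ?thesis
    by (simp cong: measurable_cong)
qed

lemma measurable_gain:
  assumes "request_distribution P" "g \<in> M \<rightarrow>\<^sub>M P" "f \<in> borel_measurable M"
    and "\<And>\<omega>. \<omega> \<in> space M \<Longrightarrow> 0 \<le> f \<omega>"
  shows "(\<lambda>\<omega>. gain (g \<omega>) (f \<omega>)) \<in> borel_measurable M"
  unfolding gain_def
  by (intro borel_measurable_diff borel_measurable_times measurable_alloc measurable_pay measurable_val assms)
    (use assms in auto)

text \<open>Countably many measurable bids suffice to approximate the optimum. The infimum is the
  generalized inverse \<open>inf {b. y \<le> alloc \<gamma> b}\<close> cut off at \<open>N\<close>; for rational \<open>y\<close> it reaches every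
  bid at which the allocation is not left-continuous. For \<open>y > 1\<close> it is the constant \<open>N\<close>.\<close>

definition candidate_bid :: "rat \<times> rat \<Rightarrow> request \<Rightarrow> real" where
  "candidate_bid = (\<lambda>(y, N) \<gamma>. max (val \<gamma>)
     (INF q\<in>{0..}. if of_rat y \<le> alloc \<gamma> (of_rat q) then of_rat q else of_rat N))"

lemma candidate_bid_ge_val: "val \<gamma> \<le> candidate_bid i \<gamma>"
  by (simp add: candidate_bid_def split_beta)

lemma candidate_bid_nonneg: "truthful_request \<gamma> \<Longrightarrow> 0 \<le> candidate_bid i \<gamma>"
  using candidate_bid_ge_val val_nonneg order_trans by blast

text \<open>The infimum runs over rational bids only, so it is a countable one.\<close>

lemma measurable_candidate_bid:
  assumes P: "request_distribution P"
  shows "candidate_bid i \<in> borel_measurable P"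
proof -
  have [measurable]: "(\<lambda>\<gamma>. alloc \<gamma> (of_rat q)) \<in> borel_measurable P" if "0 \<le> q" for q
    using that by (intro measurable_alloc[OF P]) auto
  have [measurable]: "val \<in> borel_measurable P"
    using P by (simp add: request_distribution_def)
  obtain y N where i: "i = (y, N)" by fastforce
  have "(\<lambda>\<gamma>. INF q\<in>{0..}. if of_rat y \<le> alloc \<gamma> (of_rat q) then of_rat q else of_rat N :: real)
      \<in> borel_measurable P"
    by (rule borel_measurable_cINF_real) auto
  then show ?thesis
    unfolding candidate_bid_def i prod.case by measurable
qed

lemma candidate_bid_const:
  assumes \<gamma>: "truthful_request \<gamma>"
  shows "candidate_bid (2, N) \<gamma> = max (val \<gamma>) (of_rat N)"
proof -
  have "\<not> 2 \<le> alloc \<gamma> (of_rat q)" if "0 \<le> q" for q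
    using alloc_le_1[OF \<gamma>, of "of_rat q"] that by simp
  then have "(INF q\<in>{0::rat..}. if of_rat 2 \<le> alloc \<gamma> (of_rat q) then of_rat q else of_rat N)
      = (INF q\<in>{0::rat..}. of_rat N :: real)"
    by (intro INF_cong) auto
  then show ?thesis
    by (simp add: candidate_bid_def)
qed

text \<open>Rational bids below \<open>b\<close> miss the threshold and contribute
  \<open>N > b\<close>; those above \<open>b\<close> reach it and contribute themselves. By density
  the infimum is \<open>b\<close>, and \<open>val \<gamma> \<le> b\<close> makes the outer maximum
  harmless.\<close>

lemma candidate_bid_jump:
  assumes \<gamma>: "truthful_request \<gamma>" and b: "val \<gamma> \<le> b" "b < of_rat N"
    and y: "of_rat y \<le> alloc \<gamma> b" "\<And>z. 0 \<le> z \<Longrightarrow> z < b \<Longrightarrow> alloc \<gamma> z < of_rat y"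
  shows "candidate_bid (y, N) \<gamma> = b"
proof -
  define h :: "rat \<Rightarrow> real"
    where "h q = (if of_rat y \<le> alloc \<gamma> (of_rat q) then of_rat q else of_rat N)" for q
  have b0: "0 \<le> b" using b val_nonneg[OF \<gamma>] by simp
  have ge: "b \<le> h q" if "0 \<le> q" for q
    using y(2)[of "of_rat q"] that b unfolding h_def by fastforce
  have "(INF q\<in>{0..}. h q) = b"
  proof (rule antisym)
    show "(INF q\<in>{0..}. h q) \<le> b"
    proof (rule field_le_epsilon)
      fix e :: real assume "0 < e"
      then obtain q where q: "b < of_rat q" "of_rat q < b + e"
        using of_rat_dense[of b "b + e"] by auto
      have q0: "0 \<le> q"
        using q(1) b0 by (metis le_less_trans less_imp_le zero_less_of_rat_iff)
      have "of_rat y \<le> alloc \<gamma> (of_rat q)"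
        using y(1) alloc_mono[OF \<gamma> b0, of "of_rat q"] q(1) by simp
      then have "h q = of_rat q" by (simp add: h_def)
      moreover have "(INF q\<in>{0..}. h q) \<le> h q"
        using ge q0 by (intro cINF_lower bdd_belowI2[of _ b]) auto
      ultimately show "(INF q\<in>{0..}. h q) \<le> b + e"
        using q by simp
    qed
    show "b \<le> (INF q\<in>{0..}. h q)"
      using ge by (intro cINF_greatest) auto
  qed
  then show ?thesis
    using b by (simp add: candidate_bid_def h_def)
qed

text \<open>A bid below the value is raised to the value, which improves both quantities. A bid
  above it is lowered to a rational bid if the allocation loses less than \<open>e\<close>, and the
  gain cannot drop. Otherwise the allocation jumps by at least \<open>e\<close> at \<open>b\<close>,
  and a rational threshold inside the jump recovers \<open>b\<close> exactly.\<close>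

lemma candidate_bid_approx:
  assumes \<gamma>: "truthful_request \<gamma>" and b: "0 \<le> b" and e: "0 < e"
  shows "\<exists>i. gain \<gamma> b \<le> gain \<gamma> (candidate_bid i \<gamma>) \<and> alloc \<gamma> b - e \<le> alloc \<gamma> (candidate_bid i \<gamma>)"
proof (cases "b \<le> val \<gamma>")
  case True
  have "candidate_bid (2, 0) \<gamma> = val \<gamma>"
    using val_nonneg[OF \<gamma>] by (simp add: candidate_bid_const[OF \<gamma>])
  then show ?thesis
    using gain_at_val[OF \<gamma> b] alloc_mono[OF \<gamma> b True] e by (intro exI[of _ "(2, 0)"]) auto
next
  case False
  show ?thesis
  proof (cases "\<exists>z\<ge>0. z < b \<and> alloc \<gamma> b - e < alloc \<gamma> z")
    case True
    then obtain z where z: "0 \<le> z" "z < b" "alloc \<gamma> b - e < alloc \<gamma> z" by blast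
    obtain q where q: "max z (val \<gamma>) < of_rat q" "of_rat q < b"
      using of_rat_dense[of "max z (val \<gamma>)" b] z False by auto
    then have "candidate_bid (2, q) \<gamma> = of_rat q"
      by (simp add: candidate_bid_const[OF \<gamma>])
    then show ?thesis
      using gain_antimono[OF \<gamma>, of "of_rat q" b] alloc_mono[OF \<gamma> z(1), of "of_rat q"] q z
      by (intro exI[of _ "(2, q)"]) auto
  next
    case no_approx: False
    obtain y where y: "alloc \<gamma> b - e < of_rat y" "of_rat y < alloc \<gamma> b"
      using of_rat_dense[of "alloc \<gamma> b - e" "alloc \<gamma> b"] e by auto
    obtain N where N: "b < of_rat N"
      using of_rat_dense[of b "b + 1"] by auto
    have "alloc \<gamma> z < of_rat y" if "0 \<le> z" "z < b" for z
      using no_approx that y(1) by force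
    then have "candidate_bid (y, N) \<gamma> = b"
      using False N y(2) by (intro candidate_bid_jump[OF \<gamma>]) auto
    then show ?thesis
      using e by (intro exI[of _ "(y, N)"]) auto
  qed
qed

section \<open>The hindsight optimum as a countable supremum\<close>

lemma reward_bounds:
  assumes "\<And>t. t < T \<Longrightarrow> truthful_request (\<gamma> t)" "\<And>t. t < T \<Longrightarrow> 0 \<le> b t"
  shows reward_nonneg: "0 \<le> reward T \<gamma> b" and reward_le: "reward T \<gamma> b \<le> T"
proof -
  show "0 \<le> reward T \<gamma> b"
    unfolding reward_def
    by (intro sum_nonneg mult_nonneg_nonneg) (use assms truthful_requestD in auto)
  have "reward T \<gamma> b \<le> (\<Sum>t<T. 1)"
    unfolding reward_def
    by (intro sum_mono mult_le_one) (use assms truthful_requestD in auto)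
  then show "reward T \<gamma> b \<le> T" by simp
qed

lemma spend_le_reward_iff: "spend T \<gamma> b \<le> reward T \<gamma> b \<longleftrightarrow> 0 \<le> (\<Sum>t<T. gain (\<gamma> t) (b t))"
  by (simp add: spend_def reward_def gain_def sum_subtractf)

lemma bdd_above_reward:
  assumes "\<And>t. t < T \<Longrightarrow> truthful_request (\<gamma> t)"
  shows "bdd_above (reward T \<gamma> ` feasible_bids T \<gamma>)"
  using assms reward_le by (intro bdd_aboveI2[of _ _ "real T"]) (auto simp: feasible_bids_def)

lemma zero_feasible:
  assumes "\<And>t. t < T \<Longrightarrow> truthful_request (\<gamma> t)"
  shows "(\<lambda>_. 0) \<in> feasible_bids T \<gamma>"
proof -
  have "0 \<le> (\<Sum>t<T. gain (\<gamma> t) 0)"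
    using assms by (intro sum_nonneg) (auto simp: gain_def pay_eq val_nonneg alloc_nonneg)
  then show ?thesis by (simp add: feasible_bids_def spend_le_reward_iff)
qed

lemma reward_opt_bounds:
  assumes "\<And>t. t < T \<Longrightarrow> truthful_request (\<gamma> t)"
  shows reward_opt_nonneg: "0 \<le> reward_opt T \<gamma>" and reward_opt_le: "reward_opt T \<gamma> \<le> T"
proof -
  have "0 \<le> reward T \<gamma> (\<lambda>_. 0)" using assms by (intro reward_nonneg) auto
  also have "\<dots> \<le> reward_opt T \<gamma>"
    unfolding reward_opt_def
    using zero_feasible[OF assms] bdd_above_reward[OF assms] by (intro cSUP_upper)
  finally show "0 \<le> reward_opt T \<gamma>" .
  show "reward_opt T \<gamma> \<le> T"
    unfolding reward_opt_def
    using zero_feasible[OF assms] assms reward_le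
    by (intro cSUP_least) (auto simp: feasible_bids_def)
qed

text \<open>Infeasible choices get the default 0, which never exceeds the optimum. The supremum then
  ranges over an index set that does not depend on \<open>\<gamma>\<close>.\<close>

definition candidate_reward :: "nat \<Rightarrow> (nat \<Rightarrow> request) \<Rightarrow> (nat \<Rightarrow> rat \<times> rat) \<Rightarrow> real" where
  "candidate_reward T \<gamma> j = (if 0 \<le> (\<Sum>t<T. gain (\<gamma> t) (candidate_bid (j t) (\<gamma> t)))
     then (\<Sum>t<T. val (\<gamma> t) * alloc (\<gamma> t) (candidate_bid (j t) (\<gamma> t))) else 0)"

lemma candidate_reward_le:
  assumes truthful: "\<And>t. t < T \<Longrightarrow> truthful_request (\<gamma> t)"
  shows "candidate_reward T \<gamma> j \<le> reward_opt T \<gamma>"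
proof (cases "0 \<le> (\<Sum>t<T. gain (\<gamma> t) (candidate_bid (j t) (\<gamma> t)))")
  case True
  then have "(\<lambda>t. candidate_bid (j t) (\<gamma> t)) \<in> feasible_bids T \<gamma>"
    using truthful by (simp add: feasible_bids_def spend_le_reward_iff candidate_bid_nonneg)
  then show ?thesis
    using cSUP_upper[OF _ bdd_above_reward[OF truthful]] True
    by (fastforce simp: reward_opt_def candidate_reward_def reward_def)
next
  case False
  then show ?thesis
    using reward_opt_nonneg[OF truthful] by (simp add: candidate_reward_def)
qed

text \<open>Replacing each bid by an approximating candidate loses no gain, so feasibility is
  preserved exactly and only the reward drops, by at most \<open>e\<close> in total. Extensional
  choice functions keep the index set countable.\<close>

lemma reward_opt_eq_candidate:
  assumes truthful: "\<And>t. t < T \<Longrightarrow> truthful_request (\<gamma> t)"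
  shows "reward_opt T \<gamma> = (SUP j\<in>{..<T} \<rightarrow>\<^sub>E UNIV. candidate_reward T \<gamma> j)"
proof (rule antisym)
  note le = candidate_reward_le[OF truthful]
  have ne: "({..<T} \<rightarrow>\<^sub>E (UNIV :: (rat \<times> rat) set)) \<noteq> {}"
    by (simp add: PiE_eq_empty_iff)
  show "(SUP j\<in>{..<T} \<rightarrow>\<^sub>E UNIV. candidate_reward T \<gamma> j) \<le> reward_opt T \<gamma>"
    using le by (intro cSUP_least ne)
  have bdd: "bdd_above (candidate_reward T \<gamma> ` ({..<T} \<rightarrow>\<^sub>E UNIV))"
    using le by (rule bdd_aboveI2)
  show "reward_opt T \<gamma> \<le> (SUP j\<in>{..<T} \<rightarrow>\<^sub>E UNIV. candidate_reward T \<gamma> j)"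
    unfolding reward_opt_def
  proof (rule cSUP_least)
    show "feasible_bids T \<gamma> \<noteq> {}" using zero_feasible[of T \<gamma>] truthful by blast
    fix b assume b: "b \<in> feasible_bids T \<gamma>"
    show "reward T \<gamma> b \<le> (SUP j\<in>{..<T} \<rightarrow>\<^sub>E UNIV. candidate_reward T \<gamma> j)"
    proof (rule field_le_epsilon)
      fix e :: real assume e: "0 < e"
      \<comment> \<open>The error is shared among the rounds; the \<open>+ 1\<close> covers
        \<open>T = 0\<close>.\<close>
      define d where "d = e / (real T + 1)"
      have d: "0 < d" "real T * d \<le> e"
        using e by (auto simp: d_def field_simps)
      have "\<exists>i. gain (\<gamma> t) (b t) \<le> gain (\<gamma> t) (candidate_bid i (\<gamma> t)) \<and>
          alloc (\<gamma> t) (b t) - d \<le> alloc (\<gamma> t) (candidate_bid i (\<gamma> t))" if "t < T" for t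
        using that b d truthful by (intro candidate_bid_approx) (auto simp: feasible_bids_def)
      then obtain i where i: "gain (\<gamma> t) (b t) \<le> gain (\<gamma> t) (candidate_bid (i t) (\<gamma> t))"
          "alloc (\<gamma> t) (b t) - d \<le> alloc (\<gamma> t) (candidate_bid (i t) (\<gamma> t))" if "t < T" for t
        by metis
      define j where "j = restrict i {..<T}"
      have j: "j t = i t" if "t < T" for t using that by (simp add: j_def)
      have "0 \<le> (\<Sum>t<T. gain (\<gamma> t) (b t))"
        using b by (simp add: feasible_bids_def spend_le_reward_iff)
      also have "\<dots> \<le> (\<Sum>t<T. gain (\<gamma> t) (candidate_bid (j t) (\<gamma> t)))"
        using i j by (intro sum_mono) auto
      finally have feas: "0 \<le> (\<Sum>t<T. gain (\<gamma> t) (candidate_bid (j t) (\<gamma> t)))" .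
      have "reward T \<gamma> b
          \<le> (\<Sum>t<T. val (\<gamma> t) * alloc (\<gamma> t) (candidate_bid (j t) (\<gamma> t)) + d)"
        unfolding reward_def
      proof (rule sum_mono)
        fix t assume "t \<in> {..<T}"
        then have t: "t < T" by simp
        have "val (\<gamma> t) * alloc (\<gamma> t) (b t)
            \<le> val (\<gamma> t) * (alloc (\<gamma> t) (candidate_bid (j t) (\<gamma> t)) + d)"
          using i(2)[OF t] j[OF t] val_nonneg[OF truthful[OF t]] by (intro mult_left_mono) auto
        moreover have "val (\<gamma> t) * d \<le> 1 * d"
          using val_le_1[OF truthful[OF t]] d by (intro mult_right_mono) auto
        ultimately show "val (\<gamma> t) * alloc (\<gamma> t) (b t)
            \<le> val (\<gamma> t) * alloc (\<gamma> t) (candidate_bid (j t) (\<gamma> t)) + d"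
          by (simp add: algebra_simps)
      qed
      also have "\<dots> \<le> candidate_reward T \<gamma> j + e"
        using feas d by (simp add: candidate_reward_def sum.distrib)
      also have "candidate_reward T \<gamma> j \<le> (SUP j\<in>{..<T} \<rightarrow>\<^sub>E UNIV. candidate_reward T \<gamma> j)"
        by (intro cSUP_upper bdd) (simp add: j_def PiE_iff extensional_def)
      finally show "reward T \<gamma> b \<le> (SUP j\<in>{..<T} \<rightarrow>\<^sub>E UNIV. candidate_reward T \<gamma> j) + e"
        by simp
    qed
  qed
qed

lemma truthful_in_request_seq:
  assumes "request_distribution P" "\<gamma> \<in> space (request_seq P T)" "t < T"
  shows "truthful_request (\<gamma> t)"
  using assms by (auto simp: request_seq_def space_PiM intro: truthful_in_space)

lemma measurable_request_seq_component:
  assumes "t < T"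
  shows "(\<lambda>\<gamma>. \<gamma> t) \<in> request_seq P T \<rightarrow>\<^sub>M P"
  using assms unfolding request_seq_def by (intro measurable_component_singleton) auto

lemma measurable_reward_opt:
  assumes P: "request_distribution P"
  shows "reward_opt T \<in> borel_measurable (request_seq P T)"
proof -
  note component = measurable_request_seq_component[of _ T P]
  have bid: "(\<lambda>\<gamma>. candidate_bid i (\<gamma> t)) \<in> borel_measurable (request_seq P T)" if "t < T" for i t
    using measurable_compose[OF component[OF that] measurable_candidate_bid[OF P]] .
  note nonneg = candidate_bid_nonneg[OF truthful_in_request_seq[OF P]]
  have [measurable]: "(\<lambda>\<gamma>. gain (\<gamma> t) (candidate_bid i (\<gamma> t))) \<in> borel_measurable (request_seq P T)"
    if "t < T" for i t
    using that by (intro measurable_gain[OF P component] bid nonneg) auto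
  have [measurable]: "(\<lambda>\<gamma>. val (\<gamma> t) * alloc (\<gamma> t) (candidate_bid i (\<gamma> t))) \<in> borel_measurable (request_seq P T)"
    if "t < T" for i t
    using that
    by (intro borel_measurable_times measurable_val[OF P component] measurable_alloc[OF P component] bid nonneg) auto
  have "(\<lambda>\<gamma>. SUP j\<in>{..<T} \<rightarrow>\<^sub>E UNIV. candidate_reward T \<gamma> j) \<in> borel_measurable (request_seq P T)"
  proof (rule borel_measurable_cSUP)
    show "countable ({..<T} \<rightarrow>\<^sub>E (UNIV :: (rat \<times> rat) set))"
      by (intro countable_PiE) auto
    fix j :: "nat \<Rightarrow> rat \<times> rat"
    have [measurable]: "(\<lambda>\<gamma>. \<Sum>t<T. gain (\<gamma> t) (candidate_bid (j t) (\<gamma> t))) \<in> borel_measurable (request_seq P T)"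
      by (intro borel_measurable_sum) auto
    have [measurable]: "(\<lambda>\<gamma>. \<Sum>t<T. val (\<gamma> t) * alloc (\<gamma> t) (candidate_bid (j t) (\<gamma> t))) \<in> borel_measurable (request_seq P T)"
      by (intro borel_measurable_sum) auto
    show "(\<lambda>\<gamma>. candidate_reward T \<gamma> j) \<in> borel_measurable (request_seq P T)"
      unfolding candidate_reward_def by measurable
  next
    fix \<gamma> assume "\<gamma> \<in> space (request_seq P T)"
    then show "bdd_above (candidate_reward T \<gamma> ` ({..<T} \<rightarrow>\<^sub>E UNIV))"
      using candidate_reward_le[OF truthful_in_request_seq[OF P]] by (intro bdd_aboveI2)
  qed
  then show ?thesis
    by (simp add: reward_opt_eq_candidate truthful_in_request_seq[OF P] cong: measurable_cong)
qed

section \<open>Regret\<close>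

text \<open>The multiplier is a measurable function, so that both fixed multipliers and the random
  \<open>dual_R\<close> are covered.\<close>

lemma measurable_lagrangian:
  assumes P: "request_distribution P" and g: "g \<in> M \<rightarrow>\<^sub>M P" and l: "l \<in> borel_measurable M"
    and pos: "\<And>\<omega>. 0 < l \<omega>"
  shows "(\<lambda>\<omega>. lagrangian (l \<omega>) (g \<omega>)) \<in> borel_measurable M"
    and "(\<lambda>\<omega>. dual_bid (l \<omega>) (g \<omega>)) \<in> borel_measurable M"
    and "(\<lambda>\<omega>. gain (g \<omega>) (dual_bid (l \<omega>) (g \<omega>))) \<in> borel_measurable M"
proof -
  note [measurable] = l measurable_val[OF P g]
  show bid: "(\<lambda>\<omega>. dual_bid (l \<omega>) (g \<omega>)) \<in> borel_measurable M"
    unfolding dual_bid_def by measurable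
  have nonneg: "0 \<le> dual_bid (l \<omega>) (g \<omega>)" if "\<omega> \<in> space M" for \<omega>
    using dual_bid_nonneg[OF truthful_in_space[OF P measurable_space[OF g that]] pos] .
  show gain: "(\<lambda>\<omega>. gain (g \<omega>) (dual_bid (l \<omega>) (g \<omega>))) \<in> borel_measurable M"
    by (rule measurable_gain[OF P g bid nonneg])
  have "(\<lambda>\<omega>. alloc (g \<omega>) (dual_bid (l \<omega>) (g \<omega>))) \<in> borel_measurable M"
    by (rule measurable_alloc[OF P g bid nonneg])
  with gain show "(\<lambda>\<omega>. lagrangian (l \<omega>) (g \<omega>)) \<in> borel_measurable M"
    unfolding lagrangian_def by measurable
qed

lemma measurable_dual_R:
  assumes "request_distribution P" "t \<le> T"
  shows "(\<lambda>\<gamma>. dual_R T \<gamma> t) \<in> borel_measurable (request_seq P T)"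
  using assms(2)
proof (induction t)
  case (Suc t)
  then have "(\<lambda>\<gamma>. gain (\<gamma> t) (dual_bid (dual_R T \<gamma> t) (\<gamma> t))) \<in> borel_measurable (request_seq P T)"
    by (intro measurable_lagrangian(3)[OF assms(1) measurable_request_seq_component] dual_R_pos) auto
  with Suc show ?case by simp
qed simp

lemma measurable_reward_R:
  assumes P: "request_distribution P"
  shows "(\<lambda>\<gamma>. reward T \<gamma> (algorithm_R T \<gamma>)) \<in> borel_measurable (request_seq P T)"
  unfolding reward_def algorithm_R_def
  by (intro borel_measurable_sum borel_measurable_times measurable_val[OF P] measurable_alloc[OF P]
      measurable_lagrangian(2)[OF P] measurable_request_seq_component measurable_dual_R[OF P]
      dual_R_pos dual_bid_nonneg truthful_in_request_seq[OF P]) auto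

section \<open>Integrability of the optimum and of the achieved reward\<close>

lemma prob_space_request_seq:
  assumes "request_distribution P"
  shows "prob_space (request_seq P T)"
  using assms unfolding request_seq_def by (intro prob_space_PiM) (simp add: request_distribution_def)

lemma integrable_bounded_request_seq:
  fixes f :: "(nat \<Rightarrow> request) \<Rightarrow> real"
  assumes P: "request_distribution P" and f: "f \<in> borel_measurable (request_seq P T)"
    and "\<And>\<gamma>. \<gamma> \<in> space (request_seq P T) \<Longrightarrow> \<bar>f \<gamma>\<bar> \<le> B"
  shows "integrable (request_seq P T) f"
proof -
  interpret prob_space "request_seq P T" by (rule prob_space_request_seq[OF P])
  show ?thesis using assms by (intro integrable_const_bound[of _ B] AE_I2) auto
qed

lemma integrable_reward_opt:
  assumes "request_distribution P"
  shows "integrable (request_seq P T) (reward_opt T)"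
  using reward_opt_bounds truthful_in_request_seq[OF assms]
  by (intro integrable_bounded_request_seq[OF assms measurable_reward_opt[OF assms], of T "real T"])
    (fastforce simp: abs_le_iff intro: order_trans[of "- _" 0])

lemma integrable_reward_R:
  assumes P: "request_distribution P" and T: "1 \<le> T"
  shows "integrable (request_seq P T) (\<lambda>\<gamma>. reward T \<gamma> (algorithm_R T \<gamma>))"
proof (rule integrable_bounded_request_seq[OF P measurable_reward_R[OF P]])
  fix \<gamma> assume "\<gamma> \<in> space (request_seq P T)"
  then have tr: "truthful_request (\<gamma> t)" if "t < T" for t
    using truthful_in_request_seq[OF P] that by blast
  show "\<bar>reward T \<gamma> (algorithm_R T \<gamma>)\<bar> \<le> T"
    using reward_bounds[of T \<gamma> "algorithm_R T \<gamma>"] tr algorithm_R_nonneg[OF T] by simp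
qed

text \<open>Weak duality: for feasible bids the term \<open>l\<close> times the total gain is
  nonnegative, so adding it only increases the reward, and the result is then maximized round by
  round.\<close>

lemma reward_opt_le_lagrangian:
  assumes truthful: "\<And>t. t < T \<Longrightarrow> truthful_request (\<gamma> t)" and l: "0 < l"
  shows "reward_opt T \<gamma> \<le> (\<Sum>t<T. lagrangian l (\<gamma> t))"
  unfolding reward_opt_def
proof (rule cSUP_least)
  show "feasible_bids T \<gamma> \<noteq> {}" using zero_feasible[of T \<gamma>] truthful by blast
  fix b assume b: "b \<in> feasible_bids T \<gamma>"
  then have "0 \<le> l * (\<Sum>t<T. gain (\<gamma> t) (b t))"
    using l by (simp add: feasible_bids_def spend_le_reward_iff)
  then have "reward T \<gamma> b \<le> (\<Sum>t<T. val (\<gamma> t) * alloc (\<gamma> t) (b t) + l * gain (\<gamma> t) (b t))"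
    by (simp add: reward_def sum.distrib sum_distrib_left)
  also have "\<dots> \<le> (\<Sum>t<T. lagrangian l (\<gamma> t))"
    using b truthful l by (intro sum_mono lagrangian_optimal) (auto simp: feasible_bids_def)
  finally show "reward T \<gamma> b \<le> (\<Sum>t<T. lagrangian l (\<gamma> t))" .
qed

text \<open>Each of the \<open>T\<close> requests has law \<open>P\<close>, so every term of the
  weak duality bound has the same expectation.\<close>

lemma expected_opt_le_dual:
  assumes P: "request_distribution P" and l: "0 < l"
  shows "(\<integral>\<gamma>. reward_opt T \<gamma> \<partial>request_seq P T) \<le> T * (\<integral>\<gamma>. lagrangian l \<gamma> \<partial>P)"
proof -
  have meas: "lagrangian l \<in> borel_measurable P"
    using measurable_lagrangian(1)[OF P measurable_ident_sets[OF refl], of "\<lambda>_. l"] l by simp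
  have comp: "(\<lambda>\<gamma>. lagrangian l (\<gamma> t)) \<in> borel_measurable (request_seq P T)" if "t < T" for t
    using measurable_compose[OF measurable_request_seq_component[OF that] meas] .
  have int: "integrable (request_seq P T) (\<lambda>\<gamma>. lagrangian l (\<gamma> t))" if "t < T" for t
    using that lagrangian_abs_le[OF truthful_in_request_seq[OF P] l]
    by (intro integrable_bounded_request_seq[OF P comp]) auto
  have "(\<integral>\<gamma>. reward_opt T \<gamma> \<partial>request_seq P T) \<le> (\<integral>\<gamma>. (\<Sum>t<T. lagrangian l (\<gamma> t)) \<partial>request_seq P T)"
    using int integrable_reward_opt[OF P] truthful_in_request_seq[OF P] l
    by (intro integral_mono reward_opt_le_lagrangian) auto
  also have "\<dots> = (\<Sum>t<T. \<integral>\<gamma>. lagrangian l (\<gamma> t) \<partial>request_seq P T)"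
    using int by (intro Bochner_Integration.integral_sum) auto
  also have "\<dots> = (\<Sum>t<T. \<integral>\<gamma>. lagrangian l \<gamma> \<partial>P)"
  proof (rule sum.cong[OF refl])
    fix t assume "t \<in> {..<T}"
    then have t: "t < T" by simp
    have "distr (request_seq P T) P (\<lambda>\<gamma>. \<gamma> t) = P"
      using t P unfolding request_seq_def
      by (intro distr_PiM_component[where M = "\<lambda>_. P"]) (auto simp: request_distribution_def)
    then show "(\<integral>\<gamma>. lagrangian l (\<gamma> t) \<partial>request_seq P T) = (\<integral>\<gamma>. lagrangian l \<gamma> \<partial>P)"
      using integral_distr[OF measurable_request_seq_component[OF t] meas] by simp
  qed
  finally show ?thesis by simp
qed

text \<open>Causality of the algorithm: the request of round \<open>t\<close> affects multipliers
  only from round \<open>t + 1\<close> on.\<close>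

lemma dual_R_fun_upd:
  assumes "s \<le> t"
  shows "dual_R T (\<gamma>(t := y)) s = dual_R T \<gamma> s"
  using assms by (induction s) auto

text \<open>The multiplier of round \<open>t\<close> is a function of the earlier requests, so integrating over the
  request of round \<open>t\<close> first reduces the claim to the dual bound for a fixed multiplier.\<close>

lemma expected_lagrangian_ge:
  assumes P: "request_distribution P" and t: "t < T"
  shows "integrable (request_seq P T) (\<lambda>\<gamma>. lagrangian (dual_R T \<gamma> t) (\<gamma> t))"
    and "(\<integral>\<gamma>. reward_opt T \<gamma> \<partial>request_seq P T) / T
      \<le> (\<integral>\<gamma>. lagrangian (dual_R T \<gamma> t) (\<gamma> t) \<partial>request_seq P T)"
proof -
  let ?f = "\<lambda>\<gamma>. lagrangian (dual_R T \<gamma> t) (\<gamma> t)"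
  let ?E = "\<integral>\<gamma>. reward_opt T \<gamma> \<partial>request_seq P T"
  define I where "I = {..<T} - {t}"
  have I: "finite I" "t \<notin> I" "insert t I = {..<T}"
    using t by (auto simp: I_def)
  interpret P: prob_space P using P by (simp add: request_distribution_def)
  interpret Q: prob_space "Pi\<^sub>M I (\<lambda>_. P)"
    by (intro prob_space_PiM) (rule P.prob_space_axioms)
  interpret PQ: pair_sigma_finite P "Pi\<^sub>M I (\<lambda>_. P)" ..
  show int: "integrable (request_seq P T) ?f"
  proof (rule integrable_bounded_request_seq[OF P])
    show "?f \<in> borel_measurable (request_seq P T)"
      using t by (intro measurable_lagrangian(1)[OF P] measurable_request_seq_component
          measurable_dual_R[OF P] dual_R_pos) auto
    fix \<gamma> assume \<gamma>: "\<gamma> \<in> space (request_seq P T)"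
    show "\<bar>?f \<gamma>\<bar> \<le> 1 + (2 + sqrt T)"
      using lagrangian_abs_le[OF truthful_in_request_seq[OF P \<gamma> t] dual_R_pos[of T \<gamma> t]]
        dual_R_le_horizon[of T \<gamma> t] truthful_in_request_seq[OF P \<gamma>] t by fastforce
  qed
  \<comment> \<open>Inserting an independent request \<open>y\<close> at position \<open>t\<close>
    reproduces the i.i.d. law, which splits round \<open>t\<close> off from the other
    rounds.\<close>
  define h :: "request \<times> (nat \<Rightarrow> request) \<Rightarrow> nat \<Rightarrow> request"
    where "h = (\<lambda>(y, \<gamma>). \<gamma>(t := y))"
  have h: "h \<in> P \<Otimes>\<^sub>M Pi\<^sub>M I (\<lambda>_. P) \<rightarrow>\<^sub>M request_seq P T"
    unfolding request_seq_def I(3)[symmetric] h_def split_beta'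
    by (rule measurable_fun_upd[where J = I]) auto
  have distr: "distr (P \<Otimes>\<^sub>M Pi\<^sub>M I (\<lambda>_. P)) (request_seq P T) h = request_seq P T"
    unfolding request_seq_def I(3)[symmetric] h_def
    by (rule distr_pair_PiM_eq_PiM) (rule P.prob_space_axioms)+
  have h_int: "integrable (P \<Otimes>\<^sub>M Pi\<^sub>M I (\<lambda>_. P)) (\<lambda>(y, \<gamma>). lagrangian (dual_R T \<gamma> t) y)"
    using integrable_distr[OF h, of ?f, unfolded distr, OF int]
    by (simp add: h_def split_beta' dual_R_fun_upd)
  have "integral\<^sup>L (request_seq P T) ?f
      = (\<integral>(y, \<gamma>). lagrangian (dual_R T \<gamma> t) y \<partial>(P \<Otimes>\<^sub>M Pi\<^sub>M I (\<lambda>_. P)))"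
    using integral_distr[OF h borel_measurable_integrable[OF int], unfolded distr]
    by (simp add: h_def split_beta' dual_R_fun_upd)
  also have "\<dots> = (\<integral>\<gamma>. (\<integral>y. lagrangian (dual_R T \<gamma> t) y \<partial>P) \<partial>Pi\<^sub>M I (\<lambda>_. P))"
    using PQ.integral_snd[OF h_int] by simp
  \<comment> \<open>With the other requests fixed, the multiplier is a positive constant, to which
    \<open>expected_opt_le_dual\<close> applies.\<close>
  also have "\<dots> \<ge> ?E / T"
  proof (rule Q.integral_ge_const)
    show "AE \<gamma> in Pi\<^sub>M I (\<lambda>_. P). ?E / T \<le> (\<integral>y. lagrangian (dual_R T \<gamma> t) y \<partial>P)"
      using expected_opt_le_dual[OF P dual_R_pos, of T] t by (simp add: divide_le_eq mult.commute)
    show "integrable (Pi\<^sub>M I (\<lambda>_. P)) (\<lambda>\<gamma>. \<integral>y. lagrangian (dual_R T \<gamma> t) y \<partial>P)"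
      by (rule PQ.integrable_snd[OF h_int])
  qed
  finally show "?E / T \<le> integral\<^sup>L (request_seq P T) ?f" .
qed

text \<open>Each round contributes at least a \<open>1 / T\<close> share of the expected optimum
  through its expected Lagrangian. Along every run the Lagrangians sum to the reward plus the
  weighted gains, which are at most \<open>5 * sqrt T\<close>.\<close>

lemma regret_R_le:
  assumes P: "request_distribution P" and T: "1 \<le> T"
  shows "regret algorithm_R P T \<le> 5 * sqrt T"
proof -
  interpret prob_space "request_seq P T" by (rule prob_space_request_seq[OF P])
  let ?L = "\<lambda>\<gamma>. \<Sum>t<T. lagrangian (dual_R T \<gamma> t) (\<gamma> t)"
  have intL: "integrable (request_seq P T) ?L"
    using expected_lagrangian_ge(1)[OF P] by (intro Bochner_Integration.integrable_sum) auto
  have "expectation (reward_opt T) = (\<Sum>t<T. expectation (reward_opt T) / T)"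
    using T by simp
  also have "\<dots> \<le> (\<Sum>t<T. expectation (\<lambda>\<gamma>. lagrangian (dual_R T \<gamma> t) (\<gamma> t)))"
    using expected_lagrangian_ge(2)[OF P] by (intro sum_mono) auto
  also have "\<dots> = expectation ?L"
    using expected_lagrangian_ge(1)[OF P] by (intro Bochner_Integration.integral_sum[symmetric]) auto
  also have "\<dots> \<le> expectation (\<lambda>\<gamma>. reward T \<gamma> (algorithm_R T \<gamma>) + 5 * sqrt T)"
  proof (rule integral_mono[OF intL])
    show "integrable (request_seq P T) (\<lambda>\<gamma>. reward T \<gamma> (algorithm_R T \<gamma>) + 5 * sqrt T)"
      using integrable_reward_R[OF P T] by simp
    fix \<gamma> assume "\<gamma> \<in> space (request_seq P T)"
    then show "?L \<gamma> \<le> reward T \<gamma> (algorithm_R T \<gamma>) + 5 * sqrt T"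
      using dual_gain_sum_le[OF T truthful_in_request_seq[OF P]]
      by (simp add: lagrangian_def reward_def algorithm_R_def sum.distrib)
  qed
  also have "\<dots> = expectation (\<lambda>\<gamma>. reward T \<gamma> (algorithm_R T \<gamma>)) + 5 * sqrt T"
    using integrable_reward_R[OF P T] by (simp add: prob_space)
  finally show ?thesis
    using integrable_reward_opt[OF P] integrable_reward_R[OF P T]
    by (simp add: regret_def hindsight_gap_def)
qed

theorem theorem3p1:
  shows "\<exists>C::real. \<forall>(P::request measure) (T::nat).
    request_distribution P \<longrightarrow> T \<ge> 1 \<longrightarrow>
      integrable (request_seq P T) (hindsight_gap algorithm_R T) \<and>
      regret algorithm_R P T \<le> C * sqrt (real T) \<and>
      (T \<ge> 2 \<longrightarrow>
        (\<forall>\<gamma>\<in>space (request_seq P T).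
          (\<Sum>t<T. pay (\<gamma> t) (algorithm_R T \<gamma> t))
            - (\<Sum>t<T. val (\<gamma> t) * alloc (\<gamma> t) (algorithm_R T \<gamma> t))
          \<le> 2 * sqrt (real T) * ln (real T)))"
\<comment> \<open>The constant 5 comes from \<open>dual_gain_sum_le\<close> and is uniform in
  \<open>P\<close> and \<open>T\<close>.\<close>
proof (intro exI[of _ 5] allI impI conjI ballI)
  fix P :: "request measure" and T :: nat
  assume P: "request_distribution P" and T: "1 \<le> T"
  show "integrable (request_seq P T) (hindsight_gap algorithm_R T)"
    unfolding hindsight_gap_def
    by (intro Bochner_Integration.integrable_diff integrable_reward_opt integrable_reward_R P T)
  show "regret algorithm_R P T \<le> 5 * sqrt (real T)"
    by (rule regret_R_le[OF P T])
  fix \<gamma> assume "2 \<le> T" "\<gamma> \<in> space (request_seq P T)"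
  then show "(\<Sum>t<T. pay (\<gamma> t) (algorithm_R T \<gamma> t))
      - (\<Sum>t<T. val (\<gamma> t) * alloc (\<gamma> t) (algorithm_R T \<gamma> t)) \<le> 2 * sqrt (real T) * ln (real T)"
    using violation_le[OF T truthful_in_request_seq[OF P]] by (simp add: spend_def reward_def)
qed

end
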